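(* Let $k\ge 4$ be an integer and let $\mathcal{S}_k$ be the graph with incoming vertices $i_1,\dots,i_k$ and outgoing vertices $o_1,\dots,o_k$ defined below. Then for all $j\neq m$ in $\{1,\dots,k\}$ there is no Hamiltonian path in $\mathcal{S}_k$ starting at $i_j$ and finishing at $o_m$.
   Context: A Hamiltonian path from $u$ to $w$ in a directed graph is a directed simple path starting at $u$, ending at $w$, visiting every vertex exactly once. "Undirected edge $(a,b)$" below means both directed edges $(a,b)$ and $(b,a)$. The directed graph $\mathcal{S}_k$ ($k\ge4$) has vertex set $\{1,2,\dots,2k-1\}$ and edges as follows. For even $k\ge4$: undirected edges $(4i-2,4i-1)$, $(4i-1,4i)$, $(4i,4i+1)$ for $i=1,\dots,\frac{k-2}{2}$; directed edges $(4i-2,4i+5)$ and $(4i+1,4i+2)$ for $i=1,\dots,\frac{k-4}{2}$; directed edges $(1,2)$, $(2k-6,2k-1)$, $(2k-3,2k-2)$, $(2k-2,1)$, $(2k-2,5)$, $(2k-1,2k-2)$. For odd $k\ge5$: undirected edges $(4i-2,4i-1)$, $(4i-1,4i)$, $(4i,4i+1)$ for $i=1,\dots,\frac{k-1}{2}$; directed edges $(4i-2,4i+5)$ and $(4i+1,4i+2)$ for $i=1,\dots,\frac{k-3}{2}$; directed edges $(1,2)$, $(2k-4,1)$, $(2k-2,5)$. In both cases the incoming vertices are $i_j=2j-1$ for $j=1,\dots,k$, and the outgoing vertices satisfy $o_{2j}=4j+3$ and $o_{2j+1}=4j-3$ for $j=1,\dots,\lfloor\frac{k-3}{2}\rfloor$;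 in addition, for even $k$: $o_1=3$, $o_{k-2}=2k-1$, $o_{k-1}=2k-7$, $o_k=2k-3$; for odd $k$: $o_1=2k-1$, $o_{k-1}=3$, $o_k=2k-5$. *)

theory Defs
  imports "Graph_Theory.Graph_Theory"
begin

definition hamiltonian_path :: "('a, 'b) pre_digraph \<Rightarrow> 'a \<Rightarrow> 'a list \<Rightarrow> 'a \<Rightarrow> bool" where
  "hamiltonian_path G u p w \<longleftrightarrow> vpath p G \<and> hd p = u \<and> last p = w \<and> set p = verts G"

definition undirected :: "('a \<times> 'a) set \<Rightarrow> ('a \<times> 'a) set" where
  "undirected E = E \<union> E\<inverse>"

(* Natural-number subtraction and division are exact at every index that occurs when k \<ge> 4. *)

definition S_arcs_even :: "nat \<Rightarrow> (nat \<times> nat) set" where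
  "S_arcs_even k =
     undirected (\<Union>i \<in> {1..(k - 2) div 2}. {(4*i - 2, 4*i - 1), (4*i - 1, 4*i), (4*i, 4*i + 1)})
     \<union> (\<Union>i \<in> {1..(k - 4) div 2}. {(4*i - 2, 4*i + 5), (4*i + 1, 4*i + 2)})
     \<union> {(1, 2), (2*k - 6, 2*k - 1), (2*k - 3, 2*k - 2), (2*k - 2, 1), (2*k - 2, 5),
        (2*k - 1, 2*k - 2)}"

definition S_arcs_odd :: "nat \<Rightarrow> (nat \<times> nat) set" where
  "S_arcs_odd k =
     undirected (\<Union>i \<in> {1..(k - 1) div 2}. {(4*i - 2, 4*i - 1), (4*i - 1, 4*i), (4*i, 4*i + 1)})
     \<union> (\<Union>i \<in> {1..(k - 3) div 2}. {(4*i - 2, 4*i + 5), (4*i + 1, 4*i + 2)})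
     \<union> {(1, 2), (2*k - 4, 1), (2*k - 2, 5)}"

definition S_graph :: "nat \<Rightarrow> nat pair_pre_digraph" where
  "S_graph k = \<lparr> pverts = {1..2*k - 1},
                 parcs = (if even k then S_arcs_even k else S_arcs_odd k) \<rparr>"

definition incoming :: "nat \<Rightarrow> nat" where
  "incoming j = 2*j - 1"

(* The last two branches are the general rules o_{2j} = 4j + 3 and o_{2j+1} = 4j - 3; the
   exceptional indices tested first lie outside the range 1 \<le> j \<le> (k - 3) div 2 of these rules,
   so the order of the tests is immaterial: see outgoing_general and the lemmas after it. *)
definition outgoing :: "nat \<Rightarrow> nat \<Rightarrow> nat" where
  "outgoing k m =
     (if even k \<and> m = 1 then 3
      else if even k \<and> m = k - 2 then 2*k - 1
      else if even k \<and> m = k - 1 then 2*k - 7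
      else if even k \<and> m = k then 2*k - 3
      else if odd k \<and> m = 1 then 2*k - 1
      else if odd k \<and> m = k - 1 then 3
      else if odd k \<and> m = k then 2*k - 5
      else if even m then 4*(m div 2) + 3
      else 4*(m div 2) - 3)"

lemma outgoing_general:
  assumes "k \<ge> 4" "j \<in> {1..(k - 3) div 2}"
  shows "outgoing k (2*j) = 4*j + 3" "outgoing k (2*j + 1) = 4*j - 3"
proof -
  have j: "1 \<le> j" "2*j + 3 \<le> k" using assms by auto
  have j': "even k \<Longrightarrow> 2*j + 4 \<le> k" using j(2) by presburger
  show "outgoing k (2*j) = 4*j + 3" "outgoing k (2*j + 1) = 4*j - 3"
    using j j' by (auto simp: outgoing_def)
qed

lemma outgoing_even:
  assumes "k \<ge> 4" "even k"
  shows "outgoing k 1 = 3" "outgoing k (k - 2) = 2*k - 1"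
    "outgoing k (k - 1) = 2*k - 7" "outgoing k k = 2*k - 3"
  using assms by (auto simp: outgoing_def)

lemma outgoing_odd:
  assumes "k \<ge> 4" "odd k"
  shows "outgoing k 1 = 2*k - 1" "outgoing k (k - 1) = 3" "outgoing k k = 2*k - 5"
  using assms by (auto simp: outgoing_def)

lemma pair_digraph_S_graph:
  assumes "k \<ge> 4"
  shows "pair_digraph (S_graph k)"
proof -
  have ev: "a \<in> {1..2*k - 1} \<and> b \<in> {1..2*k - 1} \<and> a \<noteq> b"
    if "(a, b) \<in> S_arcs_even k" for a b
    using that assms by (auto simp: S_arcs_even_def undirected_def)
  have od: "a \<in> {1..2*k - 1} \<and> b \<in> {1..2*k - 1} \<and> a \<noteq> b"
    if "(a, b) \<in> S_arcs_odd k" "odd k" for a b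
    using that assms by (auto simp: S_arcs_odd_def undirected_def)
  have arcs: "a \<in> {1..2*k - 1} \<and> b \<in> {1..2*k - 1} \<and> a \<noteq> b"
    if "(a, b) \<in> parcs (S_graph k)" for a b
    using that ev od by (auto simp: S_graph_def split: if_splits)
  have sub: "parcs (S_graph k) \<subseteq> {1..2*k - 1} \<times> {1..2*k - 1}"
    using arcs by auto
  have fin: "finite (parcs (S_graph k))"
    using sub by (rule finite_subset) simp
  show ?thesis
  proof
    fix e assume "e \<in> parcs (S_graph k)"
    then show "fst e \<in> pverts (S_graph k)" "snd e \<in> pverts (S_graph k)" "fst e \<noteq> snd e"
      using arcs[of "fst e" "snd e"] by (auto simp: S_graph_def)
  qed (use fin in \<open>auto simp: S_graph_def\<close>)
qed

end

theory Submission
  imports Defs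
begin

text \<open>Apart from a few exceptional vertices, the graph is a chain of four-vertex blocks, each a
  bidirected path \<open>a - b - c - d\<close>, and consecutive blocks are joined only by the arcs
  \<open>U = (a, d')\<close> and \<open>L = (d, a')\<close>. Consider which of \<open>U\<close> and \<open>L\<close> a Hamiltonian path uses before and
  after a block. A block containing neither end of the path passes on exactly one of them unchanged;
  a start at \<open>d\<close> turns \<open>{}\<close> into \<open>{U}\<close>, a start at \<open>b\<close> turns \<open>{L}\<close> into \<open>{U, L}\<close>, an end at \<open>b\<close>
  turns \<open>{U, L}\<close> into \<open>{U}\<close>, and an end at \<open>d\<close> turns \<open>{L}\<close> into \<open>{}\<close>. Since \<open>{}\<close> and \<open>{U, L}\<close>
  cannot pass through a block without an end, the starting vertex forces the end to lie in
  a neighbouring block and determines it. The exceptional vertices need a separate case analysis.\<close>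

section \<open>Hamiltonian paths as successor relations\<close>

lemma set_vwalk_arcs_conv_nth:
  "set (vwalk_arcs p) = {(p ! i, p ! Suc i) | i. Suc i < length p}"
proof (induction p rule: vwalk_arcs.induct)
  case (3 x y xs)
  have "{(((x # y # xs) ! i), (x # y # xs) ! Suc i) | i. Suc i < length (x # y # xs)}
    = insert (x, y) {((y # xs) ! i, (y # xs) ! Suc i) | i. Suc i < length (y # xs)}"
    (is "?L = ?R")
  proof (intro equalityI subsetI)
    fix e assume "e \<in> ?L"
    then obtain i where "e = ((x # y # xs) ! i, (x # y # xs) ! Suc i)" "Suc i < length (x # y # xs)"
      by blast
    then show "e \<in> ?R" by (cases i) auto
  next
    fix e assume "e \<in> ?R"
    then consider "e = (x, y)"
      | i where "e = ((y # xs) ! i, (y # xs) ! Suc i)" "Suc i < length (y # xs)" by blast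
    then show "e \<in> ?L"
    proof cases
      case 1
      then show ?thesis by (intro CollectI exI[of _ 0]) simp
    next
      case (2 i)
      then show ?thesis by (intro CollectI exI[of _ "Suc i"]) simp
    qed
  qed
  then show ?case using 3 by simp
qed auto

text \<open>\<open>R x y\<close> says that the Hamiltonian path from \<open>s\<close> to \<open>t\<close> uses the arc from \<open>x\<close> to \<open>y\<close>.
  The last axiom expresses that the path is a single chain with no cycles besides it.\<close>

locale hamiltonian_succ =
  fixes R :: "'a \<Rightarrow> 'a \<Rightarrow> bool" and V :: "'a set" and s t :: 'a
  assumes succ_unique: "R x y \<Longrightarrow> R x z \<Longrightarrow> y = z"
    and pred_unique: "R x z \<Longrightarrow> R y z \<Longrightarrow> x = y"
    and no_pred_start: "\<not> R x s"
    and no_succ_end: "\<not> R t x"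
    and succ_in: "R x y \<Longrightarrow> y \<in> V"
    and ex_succ: "x \<in> V \<Longrightarrow> x \<noteq> t \<Longrightarrow> \<exists>y. R x y"
    and ex_pred: "x \<in> V \<Longrightarrow> x \<noteq> s \<Longrightarrow> \<exists>y. R y x"
    and end_in_closed: "C \<subseteq> V \<Longrightarrow> x \<in> C \<Longrightarrow> (\<And>x y. x \<in> C \<Longrightarrow> R x y \<Longrightarrow> y \<in> C) \<Longrightarrow> t \<in> C"

text \<open>As \<open>p\<close> is distinct, a vertex determines its position, which gives the
  uniqueness axioms. A successor-closed set containing one entry contains all later ones, and so the
  last.\<close>

lemma hamiltonian_succI:
  assumes "hamiltonian_path G s p t"
  shows "hamiltonian_succ (\<lambda>x y. (x, y) \<in> set (vwalk_arcs p)) (verts G) s t"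
proof -
  have dist: "distinct p" and ne: "p \<noteq> []" and s: "s = p ! 0" and t: "t = p ! (length p - 1)"
    and V: "verts G = set p"
    using assms by (auto simp: hamiltonian_path_def vpath_def vwalk_def hd_conv_nth last_conv_nth)
  have len: "0 < length p" using ne by simp
  define R where "R x y \<longleftrightarrow> (x, y) \<in> set (vwalk_arcs p)" for x y
  have RE: "\<exists>i. Suc i < length p \<and> x = p ! i \<and> y = p ! Suc i" if "R x y" for x y
    using that by (auto simp: R_def set_vwalk_arcs_conv_nth)
  have RI: "R (p ! i) (p ! Suc i)" if "Suc i < length p" for i
    using that by (auto simp: R_def set_vwalk_arcs_conv_nth)
  note idx = nth_eq_iff_index_eq[OF dist]
  have "hamiltonian_succ R (set p) s t"
  proof
    fix x y z
    assume "R x y" "R x z"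
    then show "y = z" using RE idx by (metis Suc_lessD)
  next
    fix x y z
    assume "R x z" "R y z"
    then show "x = y" using RE idx by (metis Suc_inject)
  next
    fix x
    show "\<not> R x s" using RE[of x s] idx len s by (metis nat.distinct(1))
    show "\<not> R t x"
    proof
      assume "R t x"
      then obtain i where "Suc i < length p" "p ! (length p - 1) = p ! i" using RE t by blast
      then show False using idx[of "length p - 1" i] len by simp
    qed
  next
    fix x y
    assume "R x y"
    then show "y \<in> set p" using RE by (metis nth_mem)
  next
    fix x assume "x \<in> set p" "x \<noteq> t"
    then obtain i where i: "i < length p" "x = p ! i" "i \<noteq> length p - 1"
      by (metis in_set_conv_nth t)
    then have "Suc i < length p" by linarith
    then show "\<exists>y. R x y" using RI i by blast
  next
    fix x assume "x \<in> set p" "x \<noteq> s"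
    then obtain i where i: "i < length p" "x = p ! i" "i \<noteq> 0"
      by (metis in_set_conv_nth s)
    then obtain h where "i = Suc h" by (cases i) blast+
    then show "\<exists>y. R y x" using RI i by blast
  next
    fix C x
    assume C: "C \<subseteq> set p" "x \<in> C" and step: "\<And>x y. x \<in> C \<Longrightarrow> R x y \<Longrightarrow> y \<in> C"
    obtain i where i: "i < length p" "p ! i \<in> C" using C by (metis in_set_conv_nth subsetD)
    have "p ! (i + d) \<in> C" if "i + d < length p" for d
      using that
    proof (induction d)
      case (Suc d)
      then show ?case using step[of "p ! (i + d)"] RI[of "i + d"] by simp
    qed (use i in simp)
    from this[of "length p - 1 - i"] i show "t \<in> C" by (simp add: t)
  qed
  then show ?thesis unfolding R_def V .
qed

context hamiltonian_succ
begin

text \<open>Dual of \<open>end_in_closed\<close>: the complement of a predecessor-closed set is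
  successor-closed, so if it is nonempty it contains \<open>t\<close>.\<close>

lemma end_notin_coclosed:
  assumes "x \<in> V" "x \<notin> C" "\<And>x y. y \<in> C \<Longrightarrow> R x y \<Longrightarrow> x \<in> C"
  shows "t \<notin> C"
  using end_in_closed[of "V - C" x] assms succ_in by blast

lemma start_neq_end: "x \<in> V \<Longrightarrow> x \<noteq> s \<Longrightarrow> s \<noteq> t"
  using end_notin_coclosed[of x "{s}"] no_pred_start by auto

lemma no_two_cycle: "R x y \<Longrightarrow> \<not> R y x"
proof
  assume xy: "R x y" and yx: "R y x"
  have "t \<in> {x, y}"
    by (rule end_in_closed[of _ x]) (use xy yx succ_in succ_unique in blast)+
  then show False using xy yx no_succ_end by auto
qed

text \<open>The set \<open>{s, x, t}\<close> would be predecessor-closed and contain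
  \<open>t\<close>, yet miss \<open>y\<close>: the path would be over before visiting
  \<open>y\<close>.\<close>

lemma no_three_path:
  assumes "R s x" "R x t" "y \<in> V" "y \<notin> {s, x, t}"
  shows False
  using end_notin_coclosed[of y "{s, x, t}"] assms no_pred_start pred_unique by blast

section \<open>Forced routes through one block\<close>

text \<open>A block is a bidirected path \<open>a - b - c - d\<close> whose only further arcs enter \<open>a\<close> from \<open>la\<close>
  and \<open>d\<close> from \<open>ua\<close>, and leave \<open>a\<close> to \<open>u\<close> and \<open>d\<close> to \<open>l\<close>.\<close>

definition block :: "'a \<Rightarrow> 'a \<Rightarrow> 'a \<Rightarrow> 'a \<Rightarrow> 'a \<Rightarrow> 'a \<Rightarrow> 'a \<Rightarrow> 'a \<Rightarrow> bool" where
  "block la ua a b c d u l \<longleftrightarrow>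
     distinct [a, b, c, d] \<and> {a, b, c, d} \<subseteq> V \<and> {la, ua, u, l} \<inter> {a, b, c, d} = {} \<and>
     (\<forall>x. R x a \<longrightarrow> x = b \<or> x = la) \<and> (\<forall>x. R x b \<longrightarrow> x = a \<or> x = c) \<and>
     (\<forall>x. R x c \<longrightarrow> x = b \<or> x = d) \<and> (\<forall>x. R x d \<longrightarrow> x = c \<or> x = ua) \<and>
     (\<forall>x. R a x \<longrightarrow> x = b \<or> x = u) \<and> (\<forall>x. R b x \<longrightarrow> x = a \<or> x = c) \<and>
     (\<forall>x. R c x \<longrightarrow> x = b \<or> x = d) \<and> (\<forall>x. R d x \<longrightarrow> x = c \<or> x = l)"

text \<open>Inequality of propositions serves as exclusive or: one of the two candidate arcs must be
  used, and uniqueness forbids both. The later block lemmas are mostly propositional reasoning from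
  these facts.\<close>

lemma block_arcs:
  assumes "block la ua a b c d u l"
  shows "a \<noteq> s \<Longrightarrow> R b a \<noteq> R la a" "b \<noteq> s \<Longrightarrow> R a b \<noteq> R c b"
    "c \<noteq> s \<Longrightarrow> R b c \<noteq> R d c" "d \<noteq> s \<Longrightarrow> R c d \<noteq> R ua d"
    "a \<noteq> t \<Longrightarrow> R a b \<noteq> R a u" "b \<noteq> t \<Longrightarrow> R b a \<noteq> R b c"
    "c \<noteq> t \<Longrightarrow> R c b \<noteq> R c d" "d \<noteq> t \<Longrightarrow> R d c \<noteq> R d l"
    "\<not> (R a b \<and> R b a)" "\<not> (R b c \<and> R c b)" "\<not> (R c d \<and> R d c)"
proof -
  note B = assms[unfolded block_def]
  have V: "a \<in> V" "b \<in> V" "c \<in> V" "d \<in> V" using B by auto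
  have ne: "b \<noteq> la" "a \<noteq> c" "b \<noteq> d" "c \<noteq> ua" "b \<noteq> u" "c \<noteq> l" using B by auto
  show "a \<noteq> s \<Longrightarrow> R b a \<noteq> R la a" using B ne ex_pred[OF V(1)] pred_unique by metis
  show "b \<noteq> s \<Longrightarrow> R a b \<noteq> R c b" using B ne ex_pred[OF V(2)] pred_unique by metis
  show "c \<noteq> s \<Longrightarrow> R b c \<noteq> R d c" using B ne ex_pred[OF V(3)] pred_unique by metis
  show "d \<noteq> s \<Longrightarrow> R c d \<noteq> R ua d" using B ne ex_pred[OF V(4)] pred_unique by metis
  show "a \<noteq> t \<Longrightarrow> R a b \<noteq> R a u" using B ne ex_succ[OF V(1)] succ_unique by metis
  show "b \<noteq> t \<Longrightarrow> R b a \<noteq> R b c" using B ne ex_succ[OF V(2)] succ_unique by metis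
  show "c \<noteq> t \<Longrightarrow> R c b \<noteq> R c d" using B ne ex_succ[OF V(3)] succ_unique by metis
  show "d \<noteq> t \<Longrightarrow> R d c \<noteq> R d l" using B ne ex_succ[OF V(4)] succ_unique by metis
  show "\<not> (R a b \<and> R b a)" "\<not> (R b c \<and> R c b)" "\<not> (R c d \<and> R d c)"
    using no_two_cycle by blast+
qed

text \<open>The block is crossed in one piece, either \<open>la, a, b, c, d, l\<close> or
  \<open>ua, d, c, b, a, u\<close>.\<close>

lemma block_inner:
  assumes "block la ua a b c d u l" "s \<notin> {a, b, c, d}" "t \<notin> {a, b, c, d}"
  shows "R la a \<noteq> R ua d" "R a u = R ua d" "R d l = R la a"
  using block_arcs[OF assms(1)] assms(2,3) by auto

text \<open>The vertex \<open>c\<close> would be both the successor of \<open>s\<close> and the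
  predecessor of \<open>t\<close>, so the path would miss \<open>a\<close>.\<close>

lemma block_not_both_ends:
  assumes "block la ua a b c d u l" "(s = d \<and> t = b) \<or> (s = b \<and> t = d)"
  shows False
proof -
  have dist: "distinct [a, b, c, d]" and "a \<in> V" using assms(1) by (auto simp: block_def)
  have "R s c" "R c t"
    using block_arcs[OF assms(1)] assms(2) dist no_pred_start[of c] no_succ_end[of c] by auto
  then show False using no_three_path[of c a] \<open>a \<in> V\<close> dist assms(2) by auto
qed

text \<open>One end in the block leaves a single routing. Here it is \<open>d, c, b, a, u\<close>.
  In the next three lemmas it is \<open>b, c, d, l\<close> plus a separate visit
  \<open>la, a, u\<close>; then \<open>ua, d, c, b\<close> plus \<open>la, a, u\<close>; then
  \<open>la, a, b, c, d\<close>.\<close>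

lemma block_start_d:
  assumes B: "block la ua a b c d u l" and "s = d" "s \<noteq> t" "t \<notin> {a, c}"
  shows "\<not> R la a" "\<not> R ua d" "R a u" "\<not> R d l"
proof -
  have "distinct [a, b, c, d]" using B by (simp add: block_def)
  moreover have "t \<noteq> b" using block_not_both_ends[OF B] assms(2) by auto
  ultimately show "\<not> R la a" "\<not> R ua d" "R a u" "\<not> R d l"
    using block_arcs[OF B] assms(2-) no_pred_start[of c] no_pred_start[of ua] by auto
qed

lemma block_start_b:
  assumes B: "block la ua a b c d u l" and "s = b" "s \<noteq> t" "t \<notin> {a, c}"
  shows "R la a" "\<not> R ua d" "R a u" "R d l"
proof -
  have "distinct [a, b, c, d]" using B by (simp add: block_def)
  moreover have "t \<noteq> d" using block_not_both_ends[OF B] assms(2) by auto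
  ultimately show "R la a" "\<not> R ua d" "R a u" "R d l"
    using block_arcs[OF B] assms(2-) no_pred_start[of a] no_pred_start[of c] by auto
qed

lemma block_end_b:
  assumes B: "block la ua a b c d u l" and "t = b" "s \<noteq> t" "s \<notin> {a, c}"
  shows "R la a" "R ua d" "R a u" "\<not> R d l"
proof -
  have "distinct [a, b, c, d]" using B by (simp add: block_def)
  moreover have "s \<noteq> d" using block_not_both_ends[OF B] assms(2) by auto
  ultimately show "R la a" "R ua d" "R a u" "\<not> R d l"
    using block_arcs[OF B] assms(2-) no_succ_end[of a] no_succ_end[of c] by auto
qed

lemma block_end_d:
  assumes B: "block la ua a b c d u l" and "t = d" "s \<noteq> t" "s \<notin> {a, c}"
  shows "R la a" "\<not> R ua d" "\<not> R a u" "\<not> R d l"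
proof -
  have "distinct [a, b, c, d]" using B by (simp add: block_def)
  moreover have "s \<noteq> b" using block_not_both_ends[OF B] assms(2) by auto
  ultimately show "R la a" "\<not> R ua d" "\<not> R a u" "\<not> R d l"
    using block_arcs[OF B] assms(2-) no_succ_end[of c] no_succ_end[of l] by auto
qed

text \<open>Applied to a block next to the one containing \<open>s\<close>, or at the border of the
  chain: these patterns of arcs cannot occur unless the block contains an end, and each fits only
  one of the five routings.\<close>

lemma block_ends_from_crossings:
  assumes B: "block la ua a b c d u l" and "s \<noteq> t" "s \<notin> {a, c}" "t \<notin> {a, c}"
  shows "R la a \<Longrightarrow> R ua d \<Longrightarrow> t = b"
    and "R a u \<Longrightarrow> R d l \<Longrightarrow> s = b"
    and "\<not> R a u \<Longrightarrow> \<not> R d l \<Longrightarrow> t = d"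
proof -
  consider "s \<notin> {a, b, c, d}" "t \<notin> {a, b, c, d}" | "s = b" | "s = d" | "t = b" | "t = d"
    using assms by blast
  then have "(R la a \<longrightarrow> R ua d \<longrightarrow> t = b) \<and> (R a u \<longrightarrow> R d l \<longrightarrow> s = b) \<and>
    (\<not> R a u \<longrightarrow> \<not> R d l \<longrightarrow> t = d)"
  proof cases
    case 1
    then show ?thesis using block_inner[OF B 1] by simp
  next
    case 2
    then show ?thesis using block_start_b[OF B 2] assms(2-) by simp
  next
    case 3
    then show ?thesis using block_start_d[OF B 3] assms(2-) by simp
  next
    case 4
    then show ?thesis using block_end_b[OF B 4] assms(2-) by simp
  next
    case 5
    then show ?thesis using block_end_d[OF B 5] assms(2-) by simp
  qed
  then show "R la a \<Longrightarrow> R ua d \<Longrightarrow> t = b" "R a u \<Longrightarrow> R d l \<Longrightarrow> s = b"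
    "\<not> R a u \<Longrightarrow> \<not> R d l \<Longrightarrow> t = d"
    by simp_all
qed

end

section \<open>Chains of blocks\<close>

text \<open>Block \<open>g\<close> consists of the vertices \<open>4g + 2, \<dots>, 4g + 5\<close>; it corresponds to the index
  \<open>i = g + 1\<close> in the definition of the arcs.\<close>

locale block_chain = hamiltonian_succ R V s t
  for R :: "nat \<Rightarrow> nat \<Rightarrow> bool" and V s t +
  fixes N e f :: nat
  assumes blocks: "g < N \<Longrightarrow> block (4*g + 1) (if g = 0 then e else 4*g - 2)
      (4*g + 2) (4*g + 3) (4*g + 4) (4*g + 5) (if Suc g = N then f else 4*g + 9) (4*g + 6)"
    and N_pos: "N > 0" and odd_ends: "odd s" "odd t" and ends_neq: "s \<noteq> t"
begin

lemma ends_not_even: "s \<notin> {4*g + 2, 4*g + 4}" "t \<notin> {4*g + 2, 4*g + 4}"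
  using odd_ends by auto

text \<open>Outside the chain, \<open>e\<close> is the possible predecessor of 5, and
  \<open>f\<close> is the possible successor of \<open>4*N - 2\<close>. This lemma and the next two
  handle the two borders of the chain.\<close>

lemma first_block_both: "R 1 2 \<Longrightarrow> R e 5 \<Longrightarrow> t = 3"
  using block_ends_from_crossings(1)[OF blocks[OF N_pos] ends_neq ends_not_even]
  by (simp add: numeral_eq_Suc)

lemma last_block_both: "R (4*N - 2) f \<Longrightarrow> R (4*N + 1) (4*N + 2) \<Longrightarrow> s = 4*N - 1"
  using block_ends_from_crossings(2)[OF blocks[of "N - 1"] ends_neq ends_not_even] N_pos
  by (cases N) (simp_all add: numeral_eq_Suc)

lemma last_block_none: "\<not> R (4*N - 2) f \<Longrightarrow> \<not> R (4*N + 1) (4*N + 2) \<Longrightarrow> t = 4*N + 1"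
  using block_ends_from_crossings(3)[OF blocks[of "N - 1"] ends_neq ends_not_even] N_pos
  by (cases N) (simp_all add: numeral_eq_Suc)

text \<open>No arc enters block \<open>g\<close> from the left, so the block before it is left by no
  arc and must end the path at its last vertex. For \<open>g = 0\<close> there is no such block, and
  vertex 1 has to be examined separately.\<close>

lemma start_d:
  assumes "g < N" "s = 4*g + 5"
  shows "t = 4*g + 1 \<or> g = 0 \<and> \<not> R 1 2"
proof (cases g)
  case 0
  then show ?thesis
    using block_start_d(1)[OF blocks[OF assms(1)] assms(2) ends_neq ends_not_even(2)]
    by (simp add: numeral_eq_Suc)
next
  case (Suc h)
  have h: "h < N" "Suc h \<noteq> N" using assms Suc by auto
  have "\<not> R (4*h + 5) (4*h + 6)" "\<not> R (4*h + 2) (4*h + 9)"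
    using block_start_d(1,2)[OF blocks[OF assms(1)] assms(2) ends_neq ends_not_even(2)] Suc
    by (simp_all add: numeral_eq_Suc)
  then show ?thesis
    using block_ends_from_crossings(3)[OF blocks[OF h(1)] ends_neq ends_not_even] h Suc by simp
qed

text \<open>Both arcs leave block \<open>g\<close> to the right, so the next block is entered twice
  and the path ends at its second vertex. In the last block the outcome depends on the exceptional
  vertices.\<close>

lemma start_b:
  assumes "g < N" "s = 4*g + 3"
  shows "t = 4*g + 7 \<or> Suc g = N \<and> R (4*g + 2) f \<and> R (4*g + 5) (4*g + 6)"
proof -
  note out = block_start_b(3,4)[OF blocks[OF assms(1)] assms(2) ends_neq ends_not_even(2)]
  show ?thesis
  proof (cases "Suc g = N")
    case True
    then show ?thesis using out by simp
  next
    case False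
    then have "Suc g < N" using assms(1) by simp
    then show ?thesis
      using block_ends_from_crossings(1)[OF blocks[of "Suc g"] ends_neq ends_not_even] out False
      by (simp add: numeral_eq_Suc)
  qed
qed

end

text \<open>Apart from 1, the odd vertices up to the end of the chain are the second and fourth
  vertices of blocks.\<close>

lemma odd_le_cases:
  fixes v N :: nat
  assumes "odd v" "v \<le> 4*N + 1"
  obtains "v = 1" | g where "g < N" "v = 4*g + 3" | g where "g < N" "v = 4*g + 5"
proof -
  define q where "q = v div 4"
  have "v = 4*q + 1 \<or> v = 4*q + 3" using assms(1) unfolding q_def by presburger
  then consider "v = 1" | "v = 4*(q - 1) + 5" "q > 0" | "v = 4*q + 3" by fastforce
  then show thesis
  proof cases
    case 2
    then show ?thesis using that(3)[of "q - 1"] assms(2) by simp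
  qed (use that assms(2) in auto)
qed

section \<open>Arcs of the graph and its chain of blocks\<close>

text \<open>The shift \<open>i = h + 1\<close> removes truncated subtraction, leaving linear
  arithmetic for the arc cases.\<close>

lemma undirected_blocksE:
  fixes x y M :: nat
  assumes "(x, y) \<in> undirected
    (\<Union>i \<in> {1..M}. {(4*i - 2, 4*i - 1), (4*i - 1, 4*i), (4*i, 4*i + 1)})"
  obtains h r where "h < M" "r \<in> {2, 3, 4}"
    "x = 4*h + r \<and> y = 4*h + r + 1 \<or> x = 4*h + r + 1 \<and> y = 4*h + r"
proof -
  obtain i where i: "i \<in> {1..M}"
    and xy: "(x, y) \<in> {(4*i - 2, 4*i - 1), (4*i - 1, 4*i), (4*i, 4*i + 1)} \<or>
      (y, x) \<in> {(4*i - 2, 4*i - 1), (4*i - 1, 4*i), (4*i, 4*i + 1)}"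
    using assms unfolding undirected_def by blast
  obtain h where h: "i = Suc h" "h < M" using i by (cases i) auto
  show thesis
    using xy that[OF h(2), of 2] that[OF h(2), of 3] that[OF h(2), of 4]
    unfolding h(1) by (auto simp: numeral_eq_Suc)
qed

lemma directed_blocksE:
  fixes x y M :: nat
  assumes "(x, y) \<in> (\<Union>i \<in> {1..M}. {(4*i - 2, 4*i + 5), (4*i + 1, 4*i + 2)})"
  obtains h where "h < M" "x = 4*h + 2 \<and> y = 4*h + 9 \<or> x = 4*h + 5 \<and> y = 4*h + 6"
proof -
  obtain i where i: "i \<in> {1..M}" and xy: "(x, y) \<in> {(4*i - 2, 4*i + 5), (4*i + 1, 4*i + 2)}"
    using assms by blast
  obtain h where h: "i = Suc h" "h < M" using i by (cases i) auto
  show thesis using xy that[OF h(2)] unfolding h(1) by auto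
qed

lemma S_arcs_evenE:
  assumes "(x, y) \<in> S_arcs_even (2*N + 2)" "N > 0"
  obtains h r where "h < N" "r \<in> {2, 3, 4}"
    "x = 4*h + r \<and> y = 4*h + r + 1 \<or> x = 4*h + r + 1 \<and> y = 4*h + r"
  | h where "h + 1 < N" "x = 4*h + 2 \<and> y = 4*h + 9 \<or> x = 4*h + 5 \<and> y = 4*h + 6"
  | "x = 1" "y = 2" | "x + 2 = 4*N" "y = 4*N + 3" | "x = 4*N + 1" "y = 4*N + 2"
  | "x = 4*N + 2" "y = 1" | "x = 4*N + 2" "y = 5" | "x = 4*N + 3" "y = 4*N + 2"
proof -
  have eqs: "(2*N + 2 - 2) div 2 = N" "(2*N + 2 - 4) div 2 = N - 1" "2*(2*N + 2) - 6 = 4*N - 2"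
    "2*(2*N + 2) - 1 = 4*N + 3" "2*(2*N + 2) - 3 = 4*N + 1" "2*(2*N + 2) - 2 = 4*N + 2"
    by auto
  show thesis
    using assms(1) unfolding S_arcs_even_def eqs
  proof (elim UnE)
    assume "(x, y) \<in> undirected
      (\<Union>i \<in> {1..N}. {(4*i - 2, 4*i - 1), (4*i - 1, 4*i), (4*i, 4*i + 1)})"
    then show thesis by (elim undirected_blocksE) (rule that(1))
  next
    assume "(x, y) \<in> (\<Union>i \<in> {1..N - 1}. {(4*i - 2, 4*i + 5), (4*i + 1, 4*i + 2)})"
    then show thesis by (elim directed_blocksE) (rule that(2), auto)
  next
    assume "(x, y) \<in> {(1, 2), (4*N - 2, 4*N + 3), (4*N + 1, 4*N + 2), (4*N + 2, 1), (4*N + 2, 5),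
      (4*N + 3, 4*N + 2)}"
    then show thesis using that(3-8) assms(2) by auto
  qed
qed

lemma S_arcs_oddE:
  assumes "(x, y) \<in> S_arcs_odd (2*N + 3)"
  obtains h r where "h \<le> N" "r \<in> {2, 3, 4}"
    "x = 4*h + r \<and> y = 4*h + r + 1 \<or> x = 4*h + r + 1 \<and> y = 4*h + r"
  | h where "h < N" "x = 4*h + 2 \<and> y = 4*h + 9 \<or> x = 4*h + 5 \<and> y = 4*h + 6"
  | "x = 1" "y = 2" | "x = 4*N + 2" "y = 1" | "x = 4*N + 4" "y = 5"
proof -
  have eqs: "(2*N + 3 - 1) div 2 = Suc N" "(2*N + 3 - 3) div 2 = N" "2*(2*N + 3) - 4 = 4*N + 2"
    "2*(2*N + 3) - 2 = 4*N + 4"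
    by auto
  show thesis
    using assms(1) unfolding S_arcs_odd_def eqs
  proof (elim UnE)
    assume "(x, y) \<in> undirected
      (\<Union>i \<in> {1..Suc N}. {(4*i - 2, 4*i - 1), (4*i - 1, 4*i), (4*i, 4*i + 1)})"
    then show thesis by (elim undirected_blocksE) (rule that(1), auto)
  next
    assume "(x, y) \<in> (\<Union>i \<in> {1..N}. {(4*i - 2, 4*i + 5), (4*i + 1, 4*i + 2)})"
    then show thesis by (elim directed_blocksE) (rule that(2))
  next
    assume "(x, y) \<in> {(1, 2), (4*N + 2, 1), (4*N + 4, 5)}"
    then show thesis using that(3-5) by auto
  qed
qed

text \<open>The blocks cover 2 to \<open>4*N + 1\<close>; the exceptional vertices are 1,
  \<open>4*N + 2\<close> and \<open>4*N + 3\<close>.\<close>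

lemma block_chain_even:
  assumes H: "hamiltonian_succ R {1..4*N + 3} s t"
    and arcs: "\<And>x y. R x y \<Longrightarrow> (x, y) \<in> S_arcs_even (2*N + 2)"
    and "N > 0" "odd s" "odd t" "s \<noteq> t"
  shows "block_chain R {1..4*N + 3} s t N (4*N + 2) (4*N + 3)"
proof -
  interpret hamiltonian_succ R "{1..4*N + 3}" s t by (rule H)
  note arcE = S_arcs_evenE[OF arcs \<open>N > 0\<close>]
  show ?thesis
  proof
    fix g assume g: "g < N"
    show "block (4*g + 1) (if g = 0 then 4*N + 2 else 4*g - 2) (4*g + 2) (4*g + 3) (4*g + 4)
      (4*g + 5) (if Suc g = N then 4*N + 3 else 4*g + 9) (4*g + 6)"
      unfolding block_def
    proof (intro conjI allI impI)
      fix x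
      show "x = 4*g + 3 \<or> x = 4*g + 1" if "R x (4*g + 2)"
        by (rule arcE[OF that]; use g in \<open>auto; presburger\<close>)
      show "x = 4*g + 2 \<or> x = 4*g + 4" if "R x (4*g + 3)"
        by (rule arcE[OF that]; use g in \<open>auto; presburger\<close>)
      show "x = 4*g + 3 \<or> x = 4*g + 5" if "R x (4*g + 4)"
        by (rule arcE[OF that]; use g in \<open>auto; presburger\<close>)
      show "x = 4*g + 4 \<or> x = (if g = 0 then 4*N + 2 else 4*g - 2)" if "R x (4*g + 5)"
        by (rule arcE[OF that]; use g in \<open>auto; presburger\<close>)
      show "x = 4*g + 3 \<or> x = (if Suc g = N then 4*N + 3 else 4*g + 9)" if "R (4*g + 2) x"
        by (rule arcE[OF that]; use g in \<open>auto; presburger\<close>)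
      show "x = 4*g + 2 \<or> x = 4*g + 4" if "R (4*g + 3) x"
        by (rule arcE[OF that]; use g in \<open>auto; presburger\<close>)
      show "x = 4*g + 3 \<or> x = 4*g + 5" if "R (4*g + 4) x"
        by (rule arcE[OF that]; use g in \<open>auto; presburger\<close>)
      show "x = 4*g + 4 \<or> x = 4*g + 6" if "R (4*g + 5) x"
        by (rule arcE[OF that]; use g in \<open>auto; presburger\<close>)
    qed (use g in auto)
  qed (use assms in auto)
qed

text \<open>The last of the \<open>N + 1\<close> bidirected paths is left out of the chain: its
  third vertex \<open>4*N + 4\<close> has an extra arc to 5, which \<open>block\<close> does not
  allow.\<close>

lemma block_chain_odd:
  assumes H: "hamiltonian_succ R {1..4*N + 5} s t"
    and arcs: "\<And>x y. R x y \<Longrightarrow> (x, y) \<in> S_arcs_odd (2*N + 3)"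
    and "N > 0" "odd s" "odd t" "s \<noteq> t"
  shows "block_chain R {1..4*N + 5} s t N (4*N + 4) (4*N + 5)"
proof -
  interpret hamiltonian_succ R "{1..4*N + 5}" s t by (rule H)
  note arcE = S_arcs_oddE[OF arcs]
  show ?thesis
  proof
    fix g assume g: "g < N"
    show "block (4*g + 1) (if g = 0 then 4*N + 4 else 4*g - 2) (4*g + 2) (4*g + 3) (4*g + 4)
      (4*g + 5) (if Suc g = N then 4*N + 5 else 4*g + 9) (4*g + 6)"
      unfolding block_def
    proof (intro conjI allI impI)
      fix x
      show "x = 4*g + 3 \<or> x = 4*g + 1" if "R x (4*g + 2)"
        by (rule arcE[OF that]; use g in \<open>auto; presburger\<close>)
      show "x = 4*g + 2 \<or> x = 4*g + 4" if "R x (4*g + 3)"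
        by (rule arcE[OF that]; use g in \<open>auto; presburger\<close>)
      show "x = 4*g + 3 \<or> x = 4*g + 5" if "R x (4*g + 4)"
        by (rule arcE[OF that]; use g in \<open>auto; presburger\<close>)
      show "x = 4*g + 4 \<or> x = (if g = 0 then 4*N + 4 else 4*g - 2)" if "R x (4*g + 5)"
        by (rule arcE[OF that]; use g in \<open>auto; presburger\<close>)
      show "x = 4*g + 3 \<or> x = (if Suc g = N then 4*N + 5 else 4*g + 9)" if "R (4*g + 2) x"
        by (rule arcE[OF that]; use g in \<open>auto; presburger\<close>)
      show "x = 4*g + 2 \<or> x = 4*g + 4" if "R (4*g + 3) x"
        by (rule arcE[OF that]; use g in \<open>auto; presburger\<close>)
      show "x = 4*g + 3 \<or> x = 4*g + 5" if "R (4*g + 4) x"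
        by (rule arcE[OF that]; use g in \<open>auto; presburger\<close>)
      show "x = 4*g + 4 \<or> x = 4*g + 6" if "R (4*g + 5) x"
        by (rule arcE[OF that]; use g in \<open>auto; presburger\<close>)
    qed (use g in auto)
  qed (use assms in auto)
qed

section \<open>Possible pairs of odd ends\<close>

lemma hamiltonian_ends_even:
  assumes H: "hamiltonian_succ R {1..4*N + 3} s t"
    and arcs: "\<And>x y. R x y \<Longrightarrow> (x, y) \<in> S_arcs_even (2*N + 2)"
    and N: "N > 0" and ends: "odd s" "odd t" "s \<le> 4*N + 3"
  shows "s = 1 \<and> t = 3 \<or> s = 4*N + 3 \<and> t = 4*N + 1 \<or>
    (\<exists>g<N. s = 4*g + 5 \<and> t = 4*g + 1 \<or> s = 4*g + 3 \<and> t = 4*g + 7)"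
proof -
  interpret hamiltonian_succ R "{1..4*N + 3}" s t by (rule H)
  \<comment> \<open>A vertex other than \<open>s\<close> is needed for \<open>start_neq_end\<close>;
    2 serves since \<open>s\<close> is odd.\<close>
  have "2 \<noteq> s" using ends(1) by (metis even_numeral)
  then have "s \<noteq> t" using start_neq_end[of 2] by auto
  then interpret block_chain R "{1..4*N + 3}" s t N "4*N + 2" "4*N + 3"
    using block_chain_even[OF H arcs N] ends by auto
  note arcE = S_arcs_evenE[OF arcs N]
  have succ_1: "y = 2" if "R 1 y" for y by (rule arcE[OF that]; use N in auto)
  have succ_e: "y = 1 \<or> y = 5" if "R (4*N + 2) y" for y
    by (rule arcE[OF that]; use N in \<open>auto; presburger\<close>)
  have succ_f: "y = 4*N + 2" if "R (4*N + 3) y" for y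
    by (rule arcE[OF that]; use N in \<open>auto; presburger\<close>)
  have e: "R (4*N + 2) 1 \<or> R (4*N + 2) 5"
  proof -
    have "4*N + 2 \<noteq> t" using odd_ends by auto
    then obtain y where "R (4*N + 2) y" using ex_succ[of "4*N + 2"] by auto
    then show ?thesis using succ_e by blast
  qed
  have one: "R 1 2" if "t \<noteq> 1" using ex_succ[of 1] succ_1 that by auto
  have f: "R (4*N + 3) (4*N + 2)" if "t \<noteq> 4*N + 3" using ex_succ[of "4*N + 3"] succ_f that by auto
  show ?thesis
  proof (cases "s = 4*N + 3")
    case True
    \<comment> \<open>The vertex \<open>4*N + 2\<close> is entered from \<open>4*N + 3\<close>,
      hence not from the chain, and the other arc out of the chain would enter
      \<open>s\<close>.\<close>
    have "R (4*N + 3) (4*N + 2)" using f True ends_neq by simp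
    then have "\<not> R (4*N + 1) (4*N + 2)" using pred_unique[of "4*N + 3" _ "4*N + 1"] by fastforce
    then show ?thesis using last_block_none no_pred_start True by blast
  next
    case False
    then have "s \<le> 4*N + 1" using ends by presburger
    with ends(1) show ?thesis
    proof (cases rule: odd_le_cases)
      case 1
      then have "R 1 2" "R (4*N + 2) 5" using one e ends_neq no_pred_start by auto
      then show ?thesis using first_block_both 1 by simp
    next
      case (2 g)
      \<comment> \<open>In the last block, \<open>4*g + 7\<close> is \<open>4*N + 3\<close>. Unless
        it is the end, it must lead to \<open>4*N + 2\<close>, which already has a predecessor in
        the chain.\<close>
      have "t = 4*g + 7" if "Suc g = N" "R (4*g + 5) (4*g + 6)"
      proof (rule ccontr)
        assume "t \<noteq> 4*g + 7"
        moreover have "4*N + 3 = 4*g + 7" "4*N + 2 = 4*g + 6" using that(1) by auto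
        ultimately have "R (4*g + 7) (4*g + 6)" using f by metis
        then show False using pred_unique[OF that(2)] by fastforce
      qed
      then show ?thesis using start_b[OF 2] 2 by blast
    next
      \<comment> \<open>For \<open>g = 0\<close>, the missing arc from 1 to 2 makes 1 the end, which
        is again \<open>4*g + 1\<close>.\<close>
      case (3 g)
      then show ?thesis using start_d[OF 3] one by fastforce
    qed
  qed
qed

lemma hamiltonian_ends_odd:
  assumes H: "hamiltonian_succ R {1..4*N + 5} s t"
    and arcs: "\<And>x y. R x y \<Longrightarrow> (x, y) \<in> S_arcs_odd (2*N + 3)"
    and N: "N > 0" and ends: "odd s" "odd t" "s \<le> 4*N + 5"
  shows "s = 1 \<and> t = 4*N + 5 \<or> s = 4*N + 5 \<and> t = 4*N + 1 \<or> s = 4*N + 3 \<and> t = 3 \<or>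
    (\<exists>g<N. s = 4*g + 5 \<and> t = 4*g + 1 \<or> s = 4*g + 3 \<and> t = 4*g + 7)"
proof -
  interpret hamiltonian_succ R "{1..4*N + 5}" s t by (rule H)
  have "2 \<noteq> s" using ends(1) by (metis even_numeral)
  then have "s \<noteq> t" using start_neq_end[of 2] by auto
  then interpret block_chain R "{1..4*N + 5}" s t N "4*N + 4" "4*N + 5"
    using block_chain_odd[OF H arcs N] ends by auto
  note arcE = S_arcs_oddE[OF arcs]
  \<comment> \<open>The bidirected path outside the chain, treated by hand.\<close>
  define a b c d where abcd: "a = 4*N + 2" "b = 4*N + 3" "c = 4*N + 4" "d = 4*N + 5"
  have V: "a \<in> {1..4*N + 5}" "b \<in> {1..4*N + 5}" "c \<in> {1..4*N + 5}" "d \<in> {1..4*N + 5}"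
    "(1::nat) \<in> {1..4*N + 5}" by (auto simp: abcd)
  have ac: "a \<noteq> s" "a \<noteq> t" "c \<noteq> s" "c \<noteq> t" using odd_ends by (auto simp: abcd)
  have dist: "a \<noteq> b" "a \<noteq> c" "a \<noteq> d" "b \<noteq> c" "b \<noteq> d" "c \<noteq> d" "1 \<noteq> a" "1 \<noteq> b" "1 \<noteq> c" "1 \<noteq> d"
    "5 \<noteq> b" "5 \<noteq> d" "4*N + 1 \<noteq> b" "4*N - 2 \<noteq> c"
    using N by (auto simp: abcd)
  have succ_1: "R 1 2" if ne: "1 \<noteq> t"
  proof -
    obtain y where y: "R 1 y" using ex_succ[OF V(5) ne] by blast
    have "y = 2" by (rule arcE[OF y]) auto
    then show ?thesis using y by simp
  qed
  have pred_1: "R a 1" if ne: "1 \<noteq> s"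
  proof -
    obtain x where x: "R x 1" using ex_pred[OF V(5) ne] by blast
    have "x = a" by (rule arcE[OF x]) (auto simp: abcd)
    then show ?thesis using x by simp
  qed
  have pred_a: "R b a \<or> R (4*N + 1) a"
  proof -
    obtain x where x: "R x a" using ex_pred[OF V(1) ac(1)] by blast
    have "x = b \<or> x = 4*N + 1" by (rule arcE[OF x]) (auto simp: abcd; presburger)+
    then show ?thesis using x by blast
  qed
  have pred_b: "R a b \<or> R c b" if ne: "b \<noteq> s"
  proof -
    obtain x where x: "R x b" using ex_pred[OF V(2) ne] by blast
    have "x = a \<or> x = c" by (rule arcE[OF x]) (auto simp: abcd; presburger)+
    then show ?thesis using x by blast
  qed
  have pred_c: "R b c \<or> R d c"
  proof -
    obtain x where x: "R x c" using ex_pred[OF V(3) ac(3)] by blast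
    have "x = b \<or> x = d" by (rule arcE[OF x]) (auto simp: abcd; presburger)+
    then show ?thesis using x by blast
  qed
  have pred_d: "R c d \<or> R (4*N - 2) d" if ne: "d \<noteq> s"
  proof -
    obtain x where x: "R x d" using ex_pred[OF V(4) ne] by blast
    have "x = c \<or> x = 4*N - 2" by (rule arcE[OF x]) (use N in \<open>auto simp: abcd; presburger\<close>)+
    then show ?thesis using x by blast
  qed
  have succ_a: "R a b \<or> R a 1"
  proof -
    obtain x where x: "R a x" using ex_succ[OF V(1) ac(2)] by blast
    have "x = b \<or> x = 1" by (rule arcE[OF x]) (auto simp: abcd; presburger)+
    then show ?thesis using x by blast
  qed
  have succ_b: "R b a \<or> R b c" if ne: "b \<noteq> t"
  proof -
    obtain x where x: "R b x" using ex_succ[OF V(2) ne] by blast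
    have "x = a \<or> x = c" by (rule arcE[OF x]) (auto simp: abcd; presburger)+
    then show ?thesis using x by blast
  qed
  have succ_c: "R c b \<or> R c d \<or> R c 5"
  proof -
    obtain x where x: "R c x" using ex_succ[OF V(3) ac(4)] by blast
    have "x = b \<or> x = d \<or> x = 5" by (rule arcE[OF x]) (auto simp: abcd; presburger)+
    then show ?thesis using x by blast
  qed
  have succ_d: "R d c" if ne: "d \<noteq> t"
  proof -
    obtain x where x: "R d x" using ex_succ[OF V(4) ne] by blast
    have "x = c" by (rule arcE[OF x]) (auto simp: abcd; presburger)+
    then show ?thesis using x by blast
  qed
  have both: "s = 4*N - 1" if "R (4*N - 2) d" "R (4*N + 1) a"
    using last_block_both that by (simp add: abcd)
  have none: "t = 4*N + 1" if "\<not> R (4*N - 2) d" "\<not> R (4*N + 1) a"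
    using last_block_none that by (simp add: abcd)
  have first: "t = 3" if "R 1 2" "R c 5" using first_block_both that by (simp add: abcd)
  have "s = d \<or> s = b \<or> s \<le> 4*N + 1" using ends unfolding abcd by presburger
  then consider "s = d" | "s = b" | "s \<le> 4*N + 1" by blast
  then show ?thesis
  proof cases
    case 1
    have dc: "R d c" using succ_d 1 ends_neq by simp
    have bc: "\<not> R b c" using pred_unique[OF dc] dist by metis
    have a1: "R a 1" using pred_1 1 dist by simp
    \<comment> \<open>Otherwise the whole path would be \<open>d, c, b\<close>, since
      \<open>a\<close> leads to 1 and leaves \<open>c\<close> as the predecessor of
      \<open>b\<close>.\<close>
    have "t \<noteq> b"
    proof
      assume tb: "t = b"
      have "R c b" using pred_b 1 dist succ_unique[OF a1] by metis
      then show False using no_three_path[of c a] dc V dist 1 tb by simp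
    qed
    then have "R b a" using succ_b bc by blast
    then have "\<not> R (4*N + 1) a" using pred_unique dist by metis
    moreover have "\<not> R (4*N - 2) d" using no_pred_start 1 by simp
    ultimately show ?thesis using none 1 by (simp add: abcd)
  next
    case 2
    have a1: "R a 1" using pred_1 2 dist by simp
    have cb: "\<not> R c b" using no_pred_start 2 by simp
    have "t = 3"
    proof (cases "R b c")
      \<comment> \<open>This case is contradictory: both arcs out of the chain are used, which puts
        \<open>s\<close> at \<open>4*N - 1\<close> rather than \<open>4*N + 3\<close>.\<close>
      case True
      have "\<not> R b a" using succ_unique[OF True] dist by metis
      then have "R (4*N + 1) a" using pred_a by blast
      moreover have "R (4*N - 2) d"
      proof -
        have "\<not> R c d"
        proof
          assume cd: "R c d"
          have "t = d" using succ_d no_two_cycle[OF cd] by blast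
          then show False using no_three_path[of c a] True cd V dist 2 by simp
        qed
        then show ?thesis using pred_d 2 dist by simp
      qed
      ultimately show ?thesis using both 2 by (simp add: abcd)
    next
      \<comment> \<open>The path starts \<open>b, a, 1, 2\<close> and also uses the arc from
        \<open>c\<close> to 5, so the first block is entered twice.\<close>
      case False
      then have dc: "R d c" using pred_c by blast
      have ba: "R b a" using succ_b False 2 ends_neq by blast
      have "R c 5" using succ_c cb no_two_cycle[OF dc] by blast
      moreover have "t \<noteq> 1" using no_three_path[of a c] ba a1 2 V dist by auto
      ultimately show ?thesis using first succ_1 by auto
    qed
    then show ?thesis using 2 by (simp add: abcd)
  next
    case 3
    with ends(1) show ?thesis
    proof (cases rule: odd_le_cases)
      case 1
      have "R a b" using succ_a no_pred_start 1 by blast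
      \<comment> \<open>If \<open>d\<close> were not the end it would lead to \<open>c\<close>; both
        arcs out of the chain would then be used, so \<open>s\<close> would be
        \<open>4*N - 1\<close>.\<close>
      have "t = d"
      proof (rule ccontr)
        assume "t \<noteq> d"
        then have dc: "R d c" using succ_d by blast
        have "R (4*N - 2) d" using pred_d no_two_cycle[OF dc] 1 dist by blast
        moreover have "R (4*N + 1) a" using pred_a no_two_cycle[OF \<open>R a b\<close>] by blast
        ultimately have "s = 4*N - 1" by (rule both)
        then show False using 1 N by simp
      qed
      then show ?thesis using 1 by (simp add: abcd)
    next
      case (2 g)
      \<comment> \<open>Here \<open>4*g + 7\<close> is \<open>b\<close>. If the path went on from
        \<open>b\<close>, it would have to go to \<open>c\<close>, so \<open>b\<close> would be
        entered from \<open>a\<close>; but \<open>a\<close> leads to 1.\<close>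
      have "t = 4*g + 7" if g: "Suc g = N" "R (4*g + 2) (4*N + 5)" "R (4*g + 5) (4*g + 6)"
      proof (rule ccontr)
        assume "t \<noteq> 4*g + 7"
        then have tb: "b \<noteq> t" using g(1) by (auto simp: abcd)
        have "4*N - 2 = 4*g + 2" "4*N + 1 = 4*g + 5" "a = 4*g + 6" using g(1) by (auto simp: abcd)
        then have d: "R (4*N - 2) d" and a: "R (4*N + 1) a" using g by (simp_all only: abcd)
        have "\<not> R b a" "\<not> R c d" using pred_unique[OF a] pred_unique[OF d] dist by metis+
        then have bc: "R b c" using succ_b tb by blast
        have "s \<noteq> b" "s \<noteq> 1" using 2 by (auto simp: abcd)
        have "\<not> R c b" using no_two_cycle[OF bc] .
        then have "R a b" using pred_b \<open>s \<noteq> b\<close> by blast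
        moreover have "R a 1" using pred_1 \<open>s \<noteq> 1\<close> by blast
        ultimately show False using succ_unique dist by metis
      qed
      then show ?thesis using start_b[OF 2] 2 by blast
    next
      case (3 g)
      then show ?thesis using start_d[OF 3] succ_1 by fastforce
    qed
  qed
qed

section \<open>Comparison with the outgoing vertices\<close>

text \<open>The special values at \<open>k - 2\<close> and \<open>k - 1\<close> agree with the
  general rules once division is eliminated, so only 1 and \<open>k\<close> remain
  exceptional.\<close>

lemma outgoing_even_eq:
  assumes "N > 0" "m \<ge> 1"
  shows "outgoing (2*N + 2) m =
    (if m = 1 then 3 else if m = 2*N + 2 then 4*N + 1 else if even m then 2*m + 3 else 2*m - 5)"
proof -
  have "4 * (m div 2) = (if even m then 2*m else 2*m - 2)" by presburger
  then show ?thesis using assms unfolding outgoing_def by auto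
qed

text \<open>Here the special value at \<open>k\<close> agrees with the general rule.\<close>

lemma outgoing_odd_eq:
  assumes "N > 0" "m \<ge> 1"
  shows "outgoing (2*N + 3) m =
    (if m = 1 then 4*N + 5 else if m = 2*N + 2 then 3 else if even m then 2*m + 3 else 2*m - 5)"
proof -
  have "4 * (m div 2) = (if even m then 2*m else 2*m - 2)" by presburger
  then show ?thesis using assms unfolding outgoing_def by auto
qed

theorem theorem2:
  fixes k j m :: nat
  assumes "k \<ge> 4"
    and "j \<in> {1..k}" and "m \<in> {1..k}" and "j \<noteq> m"
  shows "\<not> (\<exists>p. hamiltonian_path (with_proj (S_graph k)) (incoming j) p (outgoing k m))"
proof
  assume "\<exists>p. hamiltonian_path (with_proj (S_graph k)) (incoming j) p (outgoing k m)"
  then obtain p where p: "hamiltonian_path (with_proj (S_graph k)) (incoming j) p (outgoing k m)"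
    by blast
  define R where "R x y \<longleftrightarrow> (x, y) \<in> set (vwalk_arcs p)" for x y
  have H: "hamiltonian_succ R {1..2*k - 1} (incoming j) (outgoing k m)"
    using hamiltonian_succI[OF p] by (simp add: R_def[abs_def] S_graph_def)
  have arcs: "(x, y) \<in> parcs (S_graph k)" if "R x y" for x y
    using p that by (auto simp: R_def hamiltonian_path_def vpath_def vwalk_def arcs_ends_def
        arc_to_ends_def)
  have j: "odd (incoming j)" "incoming j \<le> 2*k - 1"
    using assms by (auto simp: incoming_def)
  \<comment> \<open>Guarantees that \<open>2*m - 5\<close> is not truncated, so the outgoing vertex
    is odd.\<close>
  have m: "m \<ge> 3" if "odd m" "m \<noteq> 1" using that assms(3) by (cases "m = 2") auto
  show False
  proof (cases "even k")
    case True
    define N where "N = (k - 2) div 2"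
    have k: "k = 2*N + 2" "N > 0" using True assms(1) unfolding N_def by presburger+
    have mN: "1 \<le> m" "m \<le> 2*N + 2" using assms(3) k by auto
    have eq: "2*k - 1 = 4*N + 3" using k by simp
    have out: "outgoing k m = (if m = 1 then 3 else if m = 2*N + 2 then 4*N + 1
      else if even m then 2*m + 3 else 2*m - 5)"
      using outgoing_even_eq k assms(3) by simp
    have arcs': "(x, y) \<in> S_arcs_even (2*N + 2)" if "R x y" for x y
      using arcs[OF that] True k by (simp add: S_graph_def)
    \<comment> \<open>Each listed pair consists of the incoming and the outgoing vertex of one and
      the same index. Distinct indices have distinct outgoing vertices, so \<open>m = j\<close>, a
      contradiction; the odd case ends likewise.\<close>
    have "incoming j = 1 \<and> outgoing k m = 3 \<or> incoming j = 4*N + 3 \<and> outgoing k m = 4*N + 1 \<or>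
      (\<exists>g<N. incoming j = 4*g + 5 \<and> outgoing k m = 4*g + 1 \<or>
        incoming j = 4*g + 3 \<and> outgoing k m = 4*g + 7)"
      by (rule hamiltonian_ends_even[OF H[unfolded eq] arcs' k(2) j(1) _ j(2)[unfolded eq]])
        (use m in \<open>auto simp: out\<close>)
    then consider "j = 1" "outgoing k m = 3" | "j = 2*N + 2" "outgoing k m = 4*N + 1"
      | g where "g < N" "j = 2*g + 3" "outgoing k m = 4*g + 1"
      | g where "g < N" "j = 2*g + 2" "outgoing k m = 4*g + 7"
      unfolding incoming_def using assms(2) by fastforce
    then show False
      by cases (use assms(4) mN in \<open>auto simp: out split: if_splits; presburger\<close>)+
  next
    case False
    define N where "N = (k - 3) div 2"
    have k: "k = 2*N + 3" "N > 0" using False assms(1) unfolding N_def by presburger+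
    have mN: "1 \<le> m" "m \<le> 2*N + 3" using assms(3) k by auto
    have eq: "2*k - 1 = 4*N + 5" using k by simp
    have out: "outgoing k m = (if m = 1 then 4*N + 5 else if m = 2*N + 2 then 3
      else if even m then 2*m + 3 else 2*m - 5)"
      using outgoing_odd_eq k assms(3) by simp
    have arcs': "(x, y) \<in> S_arcs_odd (2*N + 3)" if "R x y" for x y
      using arcs[OF that] False k by (simp add: S_graph_def)
    have "incoming j = 1 \<and> outgoing k m = 4*N + 5 \<or> incoming j = 4*N + 5 \<and> outgoing k m = 4*N + 1 \<or>
      incoming j = 4*N + 3 \<and> outgoing k m = 3 \<or>
      (\<exists>g<N. incoming j = 4*g + 5 \<and> outgoing k m = 4*g + 1 \<or>
        incoming j = 4*g + 3 \<and> outgoing k m = 4*g + 7)"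
      by (rule hamiltonian_ends_odd[OF H[unfolded eq] arcs' k(2) j(1) _ j(2)[unfolded eq]])
        (use m in \<open>auto simp: out\<close>)
    then consider "j = 1" "outgoing k m = 4*N + 5" | "j = 2*N + 3" "outgoing k m = 4*N + 1"
      | "j = 2*N + 2" "outgoing k m = 3"
      | g where "g < N" "j = 2*g + 3" "outgoing k m = 4*g + 1"
      | g where "g < N" "j = 2*g + 2" "outgoing k m = 4*g + 7"
      unfolding incoming_def using assms(2) by fastforce
    then show False
      by cases (use assms(4) mN in \<open>auto simp: out split: if_splits; presburger\<close>)+
  qed
qed

end
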